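(* The language $$L_\vee=\{\,w\in\{a,b\}^*\mid \exists n\ge 0:\ |w|_a=n \text{ and } |w|_b\in\{n,2n\}\,\}$$ is not accepted by any repetitive deterministic finite automaton with translucent words (RDFAwtw).
   Context: $|w|_x$ denotes the number of occurrences of the letter $x$ in the word $w$. **Automata.** A repetitive finite automaton with translucent words (RNFAwtw) is a tuple $A=(Q,\Sigma,\lhd,\tau,I,\delta)$, where $Q$ is a finite set of states, $\Sigma$ is a finite input alphabet, $\lhd\notin\Sigma$ is an end-of-tape marker, $I\subseteq Q$ is the set of initial states, $\tau$ maps each state to a finite subset of $\Sigma^*$ (its translucent words), and $\delta$ is a transition function with $\delta(q,a)\subseteq Q$ for $q\in Q$, $a\in\Sigma$, and with $\delta(q,\lhd)$ either a subset of $Q$ or an element of $\{\mathsf{Accept},\mathsf{Reject}\}$ for $q\in Q$. Put $\Sigma_q=\{a\in\Sigma\mid\delta(q,a)\neq\emptyset\}$. It is required for each $q$ that, if $\tau(q)\ne\emptyset$, then $\tau(q)$ is a finite prefix code (a set of non-empty words none of which is a proper prefix of another one), and that no word of $\tau(q)$ begins with a letter of $\Sigma_q$. **Computations.** Configurations are words $qw\cdot\lhd$ ($q\in Q$, $w\in\Sigma^*$), together with $\mathsf{Accept}$ and $\mathsf{Reject}$. The single-step relation $\vdash_A$ on $qw\cdot\lhd$ is: - if $w=uav$ with $u\in(\tau(q))^*$, $a\in\Sigma_q$, $v\in\Sigma^*$, then $qw\cdot\lhd\vdash_A q'uv\cdot\lhd$ for each $q'\in\delta(q,a)$; - if $w=uav$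 with $u\in(\tau(q))^*$, $a\in\Sigma\setminus\Sigma_q$, $v\in\Sigma^*$ and $av\notin\tau(q)\cdot\Sigma^*$, then $qw\cdot\lhd\vdash_A\mathsf{Reject}$; - if $w\in(\tau(q))^*$, then $qw\cdot\lhd\vdash_A\mathsf{Accept}$ if $\delta(q,\lhd)=\mathsf{Accept}$; $qw\cdot\lhd\vdash_A\mathsf{Reject}$ if $\delta(q,\lhd)=\mathsf{Reject}$ or $\delta(q,\lhd)=\emptyset$; and $qw\cdot\lhd\vdash_A q'w\cdot\lhd$ for each $q'\in\delta(q,\lhd)$ if $\delta(q,\lhd)\subseteq Q$. The language accepted by $A$ is the set $L(A)$ of all $w\in\Sigma^*$ such that $q_0w\cdot\lhd\vdash_A^*\mathsf{Accept}$ for some $q_0\in I$, where $\vdash_A^*$ is the reflexive transitive closure of $\vdash_A$. An RNFAwtw is deterministic (an RDFAwtw) if $|I|=1$, $|\delta(q,a)|\le 1$ for all $q\in Q$, $a\in\Sigma$, and $|\delta(q,\lhd)|\le1$ whenever $\delta(q,\lhd)\subseteq Q$. *)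

theory Defs
  imports Main "HOL-Library.Sublist"
begin

datatype 'q end_move = End_Accept | End_Reject | End_Goto "'q set"

text \<open>The transition function is split into a part for letters, \<open>delta\<close>, and a part for
  the end-of-tape marker, \<open>delta_end\<close>. Hence the marker is not an object of the letter type,
  and it is automatically outside the alphabet.\<close>

record ('q, 'a) rfawtw =
  states :: "'q set"
  alphabet :: "'a set"
  transl :: "'q \<Rightarrow> 'a list set"
  initial :: "'q set"
  delta :: "'q \<Rightarrow> 'a \<Rightarrow> 'q set"
  delta_end :: "'q \<Rightarrow> 'q end_move"

definition enabled :: "('q, 'a) rfawtw \<Rightarrow> 'q \<Rightarrow> 'a set" where
  "enabled A q = {x \<in> alphabet A. delta A q x \<noteq> {}}"

definition prefix_code :: "'a list set \<Rightarrow> bool" where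
  "prefix_code C \<longleftrightarrow> [] \<notin> C \<and> (\<forall>u\<in>C. \<forall>v\<in>C. \<not> strict_prefix u v)"

definition rnfawtw :: "('q, 'a) rfawtw \<Rightarrow> bool" where
  "rnfawtw A \<longleftrightarrow>
     finite (states A) \<and> finite (alphabet A) \<and> initial A \<subseteq> states A \<and>
     (\<forall>q\<in>states A. finite (transl A q) \<and> transl A q \<subseteq> lists (alphabet A)) \<and>
     (\<forall>q\<in>states A. \<forall>x\<in>alphabet A. delta A q x \<subseteq> states A) \<and>
     (\<forall>q\<in>states A. \<forall>S. delta_end A q = End_Goto S \<longrightarrow> S \<subseteq> states A) \<and>
     (\<forall>q\<in>states A. transl A q \<noteq> {} \<longrightarrow>
        prefix_code (transl A q) \<and>
        \<not> (\<exists>x\<in>enabled A q. \<exists>v. x # v \<in> transl A q))"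

definition rdfawtw :: "('q, 'a) rfawtw \<Rightarrow> bool" where
  "rdfawtw A \<longleftrightarrow>
     rnfawtw A \<and> card (initial A) = 1 \<and>
     (\<forall>q\<in>states A. \<forall>x\<in>alphabet A. card (delta A q x) \<le> 1) \<and>
     (\<forall>q\<in>states A. \<forall>S. delta_end A q = End_Goto S \<longrightarrow> card S \<le> 1)"

definition word_star :: "'a list set \<Rightarrow> 'a list set" where
  "word_star C = concat ` lists C"

text \<open>\<open>Conf q w\<close> is the configuration consisting of the state \<open>q\<close>, the word \<open>w\<close>, and
  the end-of-tape marker.\<close>

datatype ('q, 'a) config = Conf 'q "'a list" | Accept | Reject

inductive step :: "('q, 'a) rfawtw \<Rightarrow> ('q, 'a) config \<Rightarrow> ('q, 'a) config \<Rightarrow> bool"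
  for A :: "('q, 'a) rfawtw" where
  read: "\<lbrakk>q \<in> states A; u \<in> word_star (transl A q); x \<in> enabled A q; v \<in> lists (alphabet A);
      q' \<in> delta A q x\<rbrakk> \<Longrightarrow> step A (Conf q (u @ x # v)) (Conf q' (u @ v))"
| stuck: "\<lbrakk>q \<in> states A; u \<in> word_star (transl A q); x \<in> alphabet A - enabled A q;
      v \<in> lists (alphabet A); \<not> (\<exists>t\<in>transl A q. \<exists>y\<in>lists (alphabet A). x # v = t @ y)\<rbrakk>
      \<Longrightarrow> step A (Conf q (u @ x # v)) Reject"
| end_accept: "\<lbrakk>q \<in> states A; w \<in> word_star (transl A q); delta_end A q = End_Accept\<rbrakk>
      \<Longrightarrow> step A (Conf q w) Accept"
| end_reject: "\<lbrakk>q \<in> states A; w \<in> word_star (transl A q);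
      delta_end A q = End_Reject \<or> delta_end A q = End_Goto {}\<rbrakk>
      \<Longrightarrow> step A (Conf q w) Reject"
| end_goto: "\<lbrakk>q \<in> states A; w \<in> word_star (transl A q); delta_end A q = End_Goto S; q' \<in> S\<rbrakk>
      \<Longrightarrow> step A (Conf q w) (Conf q' w)"

definition lang :: "('q, 'a) rfawtw \<Rightarrow> 'a list set" where
  "lang A = {w \<in> lists (alphabet A). \<exists>q\<in>initial A. (step A)\<^sup>*\<^sup>* (Conf q w) Accept}"

definition L_or :: "'a \<Rightarrow> 'a \<Rightarrow> 'a list set" where
  "L_or a b = {w \<in> lists {a, b}. \<exists>n::nat. count_list w a = n \<and> count_list w b \<in> {n, 2 * n}}"

end

theory Submission imports Defs begin

text \<open>Let \<open>P\<close> be a common multiple of the lengths of all translucent words and \<open>L\<close> a bound on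
  them. On \<open>a^n b^m\<close> with \<open>n, m \<ge> L\<close>, the first factor of a translucent prefix is a power of \<open>a\<close>,
  and the last factor of a translucent word is a power of \<open>b\<close>. So every non-rejecting step is
  still possible after the insertion of \<open>k\<close> letters \<open>a\<close> in front and \<open>l\<close> letters \<open>b\<close> at the end,
  whenever \<open>P\<close> divides \<open>k\<close> and \<open>l\<close>. For large \<open>n\<close>, a shortest accepting run on \<open>a^n b^n\<close> cannot
  end early, since \<open>a^(n+P) b^n\<close> would be accepted as well. Hence it visits two configurations
  that agree in the state and in both exponents modulo \<open>P\<close>. Let \<open>\<alpha>\<close> and \<open>\<beta>\<close> be the numbers of
  letters deleted in between. Repeating this segment shows that \<open>a^(n+\<alpha>) b^(n+\<beta>)\<close> is accepted.
  By determinism, the accepting run on \<open>a^n b^(2n)\<close> begins in the same way if \<open>P\<close> divides \<open>n\<close>,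
  so \<open>a^(n+\<alpha>) b^(2n+\<beta>)\<close> is accepted too. This forces \<open>\<alpha> = \<beta>\<close> and \<open>\<beta> = 2\<alpha>\<close>, so the run contains
  a loop and is not a shortest one.\<close>

section \<open>Factorizations over prefix codes\<close>

lemma word_star_append:
  assumes "u \<in> word_star C" "v \<in> word_star C"
  shows "u @ v \<in> word_star C"
proof -
  obtain us vs where "us \<in> lists C" "u = concat us" "vs \<in> lists C" "v = concat vs"
    using assms unfolding word_star_def by auto
  then have "us @ vs \<in> lists C" "u @ v = concat (us @ vs)" by auto
  then show ?thesis unfolding word_star_def by blast
qed

lemma replicate_in_word_star:
  assumes "replicate i x \<in> C" "i dvd k"
  shows "replicate k x \<in> word_star C"
proof -
  obtain r where k: "k = i * r" using assms(2) by blast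
  have "concat (replicate r (replicate i x)) = replicate (i * r) x"
    by (induction r) (simp_all add: replicate_add)
  moreover have "replicate r (replicate i x) \<in> lists C"
    using assms(1) by (auto simp: in_lists_conv_set)
  ultimately show ?thesis unfolding word_star_def k by (metis imageI)
qed

text \<open>The first code words of two factorizations of one word are prefix-comparable, hence
  equal in a prefix code. So the factors of \<open>u\<close> can be stripped off one by one.\<close>

lemma word_star_cancel_left:
  assumes "prefix_code C" "u \<in> word_star C" "u @ z \<in> word_star C"
  shows "z \<in> word_star C"
proof -
  obtain us where us: "us \<in> lists C" "u = concat us"
    using assms(2) unfolding word_star_def by auto
  have "concat us @ z \<in> word_star C \<Longrightarrow> z \<in> word_star C"
    using us(1)
  proof (induction us)
    case Nil
    then show ?case by simp
  next
    case (Cons t us)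
    then have t: "t \<in> C" "us \<in> lists C" by auto
    obtain ws where ws: "ws \<in> lists C" "concat (t # us) @ z = concat ws"
      using Cons.prems(1) unfolding word_star_def by auto
    have "t \<noteq> []" using t(1) assms(1) by (auto simp: prefix_code_def)
    then obtain s ws' where w: "ws = s # ws'" using ws by (cases ws) auto
    then have s: "s \<in> C" "ws' \<in> lists C" using ws(1) by auto
    have eq: "t @ concat us @ z = s @ concat ws'" using ws(2) w by simp
    then have "prefix t s \<or> prefix s t"
      by (metis prefixI prefix_same_cases)
    then have "t = s"
      using assms(1) t(1) s(1) unfolding prefix_code_def
      by (auto simp: strict_prefix_def)
    with eq have "concat us @ z \<in> word_star C"
      using s(2) by (auto simp: word_star_def)
    then show ?case using Cons.IH t(2) by blast
  qed
  then show ?thesis using assms(3) us(2) by blast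
qed

lemma word_star_Cons_first:
  assumes "[] \<notin> C" "x # v \<in> word_star C"
  shows "\<exists>v'. x # v' \<in> C"
proof -
  obtain ws where ws: "ws \<in> lists C" "x # v = concat ws"
    using assms(2) unfolding word_star_def by auto
  then obtain s ws' where w: "ws = s # ws'" by (cases ws) auto
  then have "s \<in> C" "s \<noteq> []" using ws(1) assms(1) by auto
  moreover have "hd s = x" using ws(2) w \<open>s \<noteq> []\<close> by (cases s) auto
  ultimately show ?thesis by (metis list.collapse)
qed

text \<open>Otherwise the longer prefix is the shorter one followed by a non-empty \<open>z\<close>,
  which factorizes by cancellation. But \<open>z\<close> begins with the letter read after the
  shorter prefix, and no code word begins with that letter.\<close>

lemma word_star_read_unique:
  assumes "prefix_code C" "u \<in> word_star C" "u' \<in> word_star C" "u @ x # v = u' @ x' # v'"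
    and "\<And>y. x # y \<notin> C" "\<And>y. x' # y \<notin> C"
  shows "u = u'"
proof -
  have nil: "[] \<notin> C" using assms(1) by (simp add: prefix_code_def)
  have *: "z = []" if pz: "p @ z \<in> word_star C" "p \<in> word_star C"
      and eq: "z @ y # r = y' # s" and y': "\<And>w. y' # w \<notin> C" for p z y r y' s
  proof (rule ccontr)
    assume "z \<noteq> []"
    then obtain z' where z: "z = y' # z'" using eq by (cases z) auto
    have "z \<in> word_star C" using word_star_cancel_left[OF assms(1) pz(2,1)] .
    then show False using word_star_Cons_first[OF nil] y' z by blast
  qed
  from assms(4) obtain us where
    "(u = u' @ us \<and> us @ x # v = x' # v') \<or> (u @ us = u' \<and> x # v = us @ x' # v')"
    by (auto simp: append_eq_append_conv2)
  then show ?thesis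
  proof
    assume "u = u' @ us \<and> us @ x # v = x' # v'"
    then show ?thesis using *[of u' us x v x' v'] assms by simp
  next
    assume "u @ us = u' \<and> x # v = us @ x' # v'"
    then show ?thesis using *[of u us x' v' x v] assms by auto
  qed
qed

section \<open>Determinism of non-rejecting steps\<close>

lemma not_step_Accept [simp]: "\<not> step A Accept c"
  by (auto elim: step.cases)

lemma not_step_Reject [simp]: "\<not> step A Reject c"
  by (auto elim: step.cases)

lemma rdfawtw_prefix_code:
  assumes "rdfawtw A" "q \<in> states A"
  shows "prefix_code (transl A q)"
  using assms by (cases "transl A q = {}") (auto simp: rdfawtw_def rnfawtw_def prefix_code_def)

lemma rdfawtw_enabled:
  assumes "rdfawtw A" "q \<in> states A" "x \<in> enabled A q"
  shows "x # y \<notin> transl A q"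
  using assms by (auto simp: rdfawtw_def rnfawtw_def)

lemma rdfawtw_delta_unique:
  assumes "rdfawtw A" "q \<in> states A" "x \<in> alphabet A" "p \<in> delta A q x" "p' \<in> delta A q x"
  shows "p = p'"
proof -
  have "delta A q x \<subseteq> states A" "finite (states A)" "card (delta A q x) \<le> Suc 0"
    using assms by (auto simp: rdfawtw_def rnfawtw_def)
  then show ?thesis using assms(4,5) by (meson card_le_Suc0_iff_eq finite_subset)
qed

lemma rdfawtw_goto_unique:
  assumes "rdfawtw A" "q \<in> states A" "delta_end A q = End_Goto S" "p \<in> S" "p' \<in> S"
  shows "p = p'"
proof -
  have "S \<subseteq> states A" "finite (states A)" "card S \<le> Suc 0"
    using assms by (auto simp: rdfawtw_def rnfawtw_def)
  then show ?thesis using assms(4,5) by (meson card_le_Suc0_iff_eq finite_subset)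
qed

lemma step_cases_not_Reject [consumes 2, case_names read accept goto]:
  assumes "step A (Conf q w) d" "d \<noteq> Reject"
  obtains u x v q' where "q \<in> states A" "w = u @ x # v" "u \<in> word_star (transl A q)"
      "x \<in> enabled A q" "v \<in> lists (alphabet A)" "q' \<in> delta A q x" "d = Conf q' (u @ v)"
    | "q \<in> states A" "w \<in> word_star (transl A q)" "delta_end A q = End_Accept" "d = Accept"
    | S q' where "q \<in> states A" "w \<in> word_star (transl A q)" "delta_end A q = End_Goto S"
      "q' \<in> S" "d = Conf q' w"
  using assms by (cases rule: step.cases) auto

text \<open>Cancelling \<open>u\<close> would leave a factorization of \<open>x # v\<close>, so a
  translucent word would begin with the enabled letter \<open>x\<close>. Hence reading and
  end-of-tape moves exclude each other.\<close>

lemma read_not_end: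
  assumes "rdfawtw A" "q \<in> states A" "u \<in> word_star (transl A q)" "x \<in> enabled A q"
  shows "u @ x # v \<notin> word_star (transl A q)"
proof
  assume "u @ x # v \<in> word_star (transl A q)"
  then have "x # v \<in> word_star (transl A q)"
    by (rule word_star_cancel_left[OF rdfawtw_prefix_code[OF assms(1,2)] assms(3)])
  moreover have "[] \<notin> transl A q"
    using rdfawtw_prefix_code[OF assms(1,2)] by (simp add: prefix_code_def)
  ultimately show False
    using word_star_Cons_first[of "transl A q" x v] rdfawtw_enabled[OF assms(1,2,4)] by blast
qed

lemma step_deterministic:
  assumes A: "rdfawtw A" and d: "step A c d" "d \<noteq> Reject" and d': "step A c d'" "d' \<noteq> Reject"
  shows "d = d'"
proof -
  obtain q w where c: "c = Conf q w" using d(1) by (cases c) auto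
  from d(1)[unfolded c] d(2) show ?thesis
  proof (cases rule: step_cases_not_Reject)
    case 1: (read u x v p)
    from d'(1)[unfolded c] d'(2) show ?thesis
    proof (cases rule: step_cases_not_Reject)
      case 2: (read u' x' v' p')
      have "u = u'"
        using word_star_read_unique[of "transl A q" u u' x v x' v']
          rdfawtw_prefix_code[OF A] rdfawtw_enabled[OF A] 1 2 by metis
      then have "x = x'" "v = v'" using 1 2 by auto
      moreover have "x \<in> alphabet A" using 1 by (auto simp: enabled_def)
      ultimately show ?thesis using 1 2 \<open>u = u'\<close> rdfawtw_delta_unique[OF A] by blast
    qed (use 1 read_not_end[OF A] in blast)+
  next
    case 1: accept
    from d'(1)[unfolded c] d'(2) show ?thesis
      by (cases rule: step_cases_not_Reject) (use 1 read_not_end[OF A] in auto)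
  next
    case 1: (goto S p)
    from d'(1)[unfolded c] d'(2) show ?thesis
      by (cases rule: step_cases_not_Reject)
        (use 1 read_not_end[OF A] rdfawtw_goto_unique[OF A] in auto)
  qed
qed

text \<open>By determinism, each non-rejecting step towards \<open>d\<close> is also the next step
  of the accepting run, so \<open>d\<close> lies on that run.\<close>

lemma accepting_run_unique:
  assumes A: "rdfawtw A" and "(step A)\<^sup>*\<^sup>* c d" "(step A)\<^sup>*\<^sup>* c Accept" "d \<noteq> Reject"
  shows "(step A)\<^sup>*\<^sup>* d Accept"
  using assms(2,4)
proof (induction rule: rtranclp_induct)
  case base
  then show ?case using assms(3) by simp
next
  case (step y z)
  have "y \<noteq> Reject" "y \<noteq> Accept" using step.hyps(2) by auto
  then obtain e where e: "step A y e" "(step A)\<^sup>*\<^sup>* e Accept"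
    using step.IH by (metis converse_rtranclpE)
  have "e \<noteq> Reject" using e(2) by (auto elim: converse_rtranclpE)
  then show ?case using step_deterministic[OF A step.hyps(2) step.prems e(1)] e(2) by simp
qed

section \<open>Pumping a block of equal letters\<close>

lemma prefix_replicate_eq:
  assumes "t @ r = replicate n a @ s" "length t \<le> n"
  shows "t = replicate (length t) a"
proof -
  have "t = take (length t) (replicate n a @ s)" using assms(1) by (metis append_eq_conv_conj)
  then show ?thesis using assms(2) by (simp add: min_def)
qed

lemma suffix_replicate_eq:
  assumes "r @ t = s @ replicate n a" "length t \<le> n"
  shows "t = replicate (length t) a"
proof -
  have "rev t @ rev r = replicate n a @ rev s"
    using arg_cong[OF assms(1), of rev] by simp
  then have "rev t = replicate (length t) a"
    using prefix_replicate_eq[of "rev t"] assms(2) by simp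
  then show ?thesis by (metis rev_replicate rev_rev_ident)
qed

text \<open>The first factor of \<open>u\<close> fits into the leading block, so it is a power of
  \<open>a\<close>. Its length divides \<open>k\<close>, so repeating it yields
  \<open>replicate k a\<close>. The rest \<open>r\<close> is present because a reading step
  factorizes only a prefix of the tape.\<close>

lemma word_star_pump_front:
  assumes len: "\<And>t. t \<in> C \<Longrightarrow> length t \<le> n \<and> length t dvd k"
    and u: "u \<in> word_star C" "u \<noteq> []" "u @ r = replicate n a @ s"
  shows "replicate k a @ u \<in> word_star C"
proof -
  obtain ts where ts: "ts \<in> lists C" "u = concat ts"
    using u(1) unfolding word_star_def by auto
  then obtain t ts' where t: "ts = t # ts'" using u(2) by (cases ts) auto
  then have "t \<in> C" using ts by simp
  moreover have "t @ concat ts' @ r = replicate n a @ s" using u(3) ts t by simp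
  ultimately have "replicate (length t) a \<in> C"
    using prefix_replicate_eq len by metis
  then have "replicate k a \<in> word_star C"
    using len[OF \<open>t \<in> C\<close>] by (intro replicate_in_word_star) auto
  then show ?thesis using u(1) by (intro word_star_append)
qed

lemma word_star_pump_back:
  assumes len: "\<And>t. t \<in> C \<Longrightarrow> length t \<le> n \<and> length t dvd k"
    and u: "u \<in> word_star C" "u \<noteq> []" "u = s @ replicate n a"
  shows "u @ replicate k a \<in> word_star C"
proof -
  obtain ts where ts: "ts \<in> lists C" "u = concat ts"
    using u(1) unfolding word_star_def by auto
  then obtain t ts' where t: "ts = ts' @ [t]" using u(2) by (cases ts rule: rev_cases) auto
  then have "t \<in> C" using ts by simp
  moreover have "concat ts' @ t = s @ replicate n a" using u(3) ts t by simp
  ultimately have "replicate (length t) a \<in> C"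
    using suffix_replicate_eq len by metis
  then have "replicate k a \<in> word_star C"
    using len[OF \<open>t \<in> C\<close>] by (intro replicate_in_word_star) auto
  then show ?thesis using u(1) by (intro word_star_append)
qed

section \<open>Two-block words and the padding of runs\<close>

definition two_block :: "'a \<Rightarrow> 'a \<Rightarrow> nat \<Rightarrow> nat \<Rightarrow> 'a list" where
  "two_block a b n m = replicate n a @ replicate m b"

text \<open>The deletion hits one block, but the bounds treat both alike: in this form they also
  describe end-of-tape moves and add up along runs.\<close>

lemma two_block_delete:
  assumes "two_block a b n m = u @ x # v"
  obtains n' m' where "u @ v = two_block a b n' m'" "n' \<le> n" "n \<le> n' + 1" "m' \<le> m" "m \<le> m' + 1"
proof (cases "length u < n")
  case True
  have "u = take (length u) (two_block a b n m)" "v = drop (Suc (length u)) (two_block a b n m)"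
    using assms by auto
  then have "u = replicate (length u) a" "v = replicate (n - Suc (length u)) a @ replicate m b"
    using True by (auto simp: two_block_def min_def)
  then have "u @ v = two_block a b (length u + (n - Suc (length u))) m"
    by (metis append.assoc replicate_add two_block_def)
  then have "u @ v = two_block a b (n - 1) m" using True by simp
  then show ?thesis using that True by force
next
  case False
  have "n + m = length u + Suc (length v)"
    using arg_cong[OF assms, of length] by (simp add: two_block_def)
  have "u = take (length u) (two_block a b n m)" "v = drop (Suc (length u)) (two_block a b n m)"
    using assms by auto
  then have "u = replicate n a @ replicate (length u - n) b"
      "v = replicate (length v) b"
    using False \<open>n + m = length u + Suc (length v)\<close>
    by (auto simp: two_block_def min_def split: if_splits)
  then have "u @ v = two_block a b n (length u - n + length v)"
    by (metis append.assoc replicate_add two_block_def)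
  moreover have "length u - n + length v = m - 1"
    using False \<open>n + m = length u + Suc (length v)\<close> by simp
  ultimately have "u @ v = two_block a b n (m - 1)" by simp
  then show ?thesis using that False \<open>n + m = length u + Suc (length v)\<close> by force
qed

fun pad :: "'a \<Rightarrow> 'a \<Rightarrow> nat \<Rightarrow> nat \<Rightarrow> ('q, 'a) config \<Rightarrow> ('q, 'a) config" where
  "pad a b k l (Conf q w) = Conf q (replicate k a @ w @ replicate l b)"
| "pad a b k l Accept = Accept"
| "pad a b k l Reject = Reject"

declare pad.simps(1) [simp del]

text \<open>Takes the place of the defining equation as a simp rule, so that padded tapes stay
  visible as two-block words.\<close>

lemma pad_two_block [simp]:
  "pad a b k l (Conf q (two_block a b n m)) = Conf q (two_block a b (n + k) (m + l))"
proof -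
  have "replicate (n + k) a = replicate k a @ replicate n a"
    by (simp add: replicate_add add.commute)
  then show ?thesis by (simp add: two_block_def replicate_add pad.simps(1))
qed

locale periodic_rdfawtw =
  fixes A :: "('q, 'a) rfawtw" and a b :: 'a and L P :: nat
  assumes det: "rdfawtw A"
    and letters: "a \<in> alphabet A" "b \<in> alphabet A"
    and lengths: "q \<in> states A \<Longrightarrow> t \<in> transl A q \<Longrightarrow> length t \<le> L \<and> length t dvd P"
    and L_pos: "0 < L"
begin

text \<open>A reading step needs pumping only in front of \<open>u\<close>, since the letters behind
  the one read merely have to lie in the alphabet. An end-of-tape move factorizes the whole tape and
  needs pumping on both sides.\<close>

lemma step_pad:
  assumes "step A (Conf q (two_block a b n m)) d" "d \<noteq> Reject" "L \<le> n" "L \<le> m"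
    and "P dvd k" "P dvd l"
  shows "step A (pad a b k l (Conf q (two_block a b n m))) (pad a b k l d)"
proof -
  let ?w = "two_block a b n m"
  have n: "0 < n" "0 < m" using assms(3,4) L_pos by auto
  have len: "length t \<le> n \<and> length t dvd k" "length t \<le> m \<and> length t dvd l"
    if "q \<in> states A" "t \<in> transl A q" for t
    using lengths[OF that] assms(3-6) by (auto dest: dvd_trans)
  have star: "replicate k a @ ?w @ replicate l b \<in> word_star (transl A q)"
    if "q \<in> states A" "?w \<in> word_star (transl A q)"
  proof -
    have "?w @ replicate l b \<in> word_star (transl A q)"
      using word_star_pump_back[of "transl A q" m l ?w "replicate n a" b] len that n
      by (simp add: two_block_def)
    then show ?thesis
      using word_star_pump_front[of "transl A q" n k "?w @ replicate l b" "[]" a] len that n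
      by (simp add: two_block_def)
  qed
  from assms(1,2) show ?thesis
  proof (cases rule: step_cases_not_Reject)
    case (read u x v q')
    have v: "v @ replicate l b \<in> lists (alphabet A)" "replicate k a \<in> lists (alphabet A)"
      using letters read(5) by auto
    show ?thesis
    \<comment> \<open>An empty \<open>u\<close> has no factor to pump, but then the letter read is
      \<open>a\<close>. On the padded tape the leading \<open>a\<close> is deleted instead, with the
      same resulting word.\<close>
    proof (cases "u = []")
      case True
      then have "x = a" using read(2) n by (cases n) (auto simp: two_block_def)
      then have eq: "replicate k a @ ?w @ replicate l b = [] @ x # (replicate k a @ v @ replicate l b)"
        using read(2) True by (simp add: replicate_app_Cons_same)
      have "[] \<in> word_star (transl A q)" using read(3) True by simp
      then have "step A (Conf q (replicate k a @ ?w @ replicate l b))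
          (Conf q' ([] @ (replicate k a @ v @ replicate l b)))"
        unfolding eq using read v by (intro step.read) auto
      then show ?thesis using read(7) True by (simp add: pad.simps(1) del: pad_two_block)
    next
      case False
      have "replicate k a @ u \<in> word_star (transl A q)"
        using word_star_pump_front[of "transl A q" n k u "x # v" a "replicate m b"]
          len read(1,3) read(2)[symmetric] False
        by (simp add: two_block_def)
      then have "step A (Conf q ((replicate k a @ u) @ x # (v @ replicate l b)))
          (Conf q' ((replicate k a @ u) @ (v @ replicate l b)))"
        using read v by (intro step.read) auto
      then show ?thesis using read(2,7) by (simp add: pad.simps(1) del: pad_two_block)
    qed
  next
    case accept
    then have "step A (Conf q (replicate k a @ ?w @ replicate l b)) Accept"
      using star by (intro step.end_accept)
    then show ?thesis using accept(4) by (simp add: pad.simps(1) del: pad_two_block)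
  next
    case (goto S q')
    then have "step A (Conf q (replicate k a @ ?w @ replicate l b))
        (Conf q' (replicate k a @ ?w @ replicate l b))"
      using star by (intro step.end_goto)
    then show ?thesis using goto(5) by (simp add: pad.simps(1) del: pad_two_block)
  qed
qed

lemma step_two_block:
  assumes "step A (Conf q (two_block a b n m)) (Conf q' w)"
  obtains n' m' where "q' \<in> states A" "w = two_block a b n' m'"
    "n' \<le> n" "n \<le> n' + 1" "m' \<le> m" "m \<le> m' + 1"
proof -
  have "q' \<in> states A"
  proof -
    have *: "delta A q x \<subseteq> states A" if "q \<in> states A" "x \<in> enabled A q" for x
      using det that by (simp add: rdfawtw_def rnfawtw_def enabled_def)
    have **: "S \<subseteq> states A" if "q \<in> states A" "delta_end A q = End_Goto S" for S
      using det that by (simp add: rdfawtw_def rnfawtw_def)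
    from assms show ?thesis by cases (use * ** in blast)+
  qed
  moreover have "w = two_block a b n m \<or> (\<exists>u x v. two_block a b n m = u @ x # v \<and> w = u @ v)"
    using assms by (cases rule: step.cases) blast+
  then have "\<exists>n' m'. w = two_block a b n' m' \<and> n' \<le> n \<and> n \<le> n' + 1 \<and> m' \<le> m \<and> m \<le> m' + 1"
  proof
    assume "w = two_block a b n m"
    then show ?thesis by (intro exI[of _ n] exI[of _ m]) simp
  next
    assume "\<exists>u x v. two_block a b n m = u @ x # v \<and> w = u @ v"
    then show ?thesis using two_block_delete by metis
  qed
  ultimately show ?thesis using that by blast
qed

lemma run_two_block:
  assumes "(step A ^^ i) (Conf q (two_block a b n m)) (Conf q' w)" "q \<in> states A"
  obtains n' m' where "q' \<in> states A" "w = two_block a b n' m'"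
    "n' \<le> n" "n \<le> n' + i" "m' \<le> m" "m \<le> m' + i"
proof -
  have "\<exists>n' m'. q' \<in> states A \<and> w = two_block a b n' m' \<and>
      n' \<le> n \<and> n \<le> n' + i \<and> m' \<le> m \<and> m \<le> m' + i"
    using assms(1)
  proof (induction i arbitrary: q' w)
    case 0
    then show ?case using assms(2) by auto
  next
    case (Suc i)
    then obtain y where y: "(step A ^^ i) (Conf q (two_block a b n m)) y" "step A y (Conf q' w)"
      by auto
    then obtain p v where yp: "y = Conf p v" by (cases y) auto
    then obtain n1 m1 where 1: "v = two_block a b n1 m1"
        "n1 \<le> n" "n \<le> n1 + i" "m1 \<le> m" "m \<le> m1 + i"
      using Suc.IH y by blast
    obtain n2 m2 where "q' \<in> states A" "w = two_block a b n2 m2"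
        "n2 \<le> n1" "n1 \<le> n2 + 1" "m2 \<le> m1" "m1 \<le> m2 + 1"
      using y(2) step_two_block unfolding yp 1(1) by blast
    then show ?case using 1 by (intro exI[of _ n2] exI[of _ m2]) auto
  qed
  then show ?thesis using that by blast
qed

text \<open>Before each of the \<open>i\<close> steps fewer than \<open>i\<close> letters have gone
  from either block, so both blocks still have length at least \<open>L\<close> and
  \<open>step_pad\<close> applies.\<close>

lemma run_pad:
  assumes "(step A ^^ i) (Conf q (two_block a b n m)) d" "d \<noteq> Reject" "q \<in> states A"
    and "L + i \<le> n" "L + i \<le> m" "P dvd k" "P dvd l"
  shows "(step A ^^ i) (Conf q (two_block a b (n + k) (m + l))) (pad a b k l d)"
  using assms(1,2,4,5)
proof (induction i arbitrary: d)
  case 0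
  then show ?case by auto
next
  case (Suc i)
  then obtain y where y: "(step A ^^ i) (Conf q (two_block a b n m)) y" "step A y d" by auto
  then obtain p v where yp: "y = Conf p v" by (cases y) auto
  obtain n1 m1 where 1: "v = two_block a b n1 m1" "n \<le> n1 + i" "m \<le> m1 + i"
    using run_two_block y(1) assms(3) unfolding yp by metis
  have "step A (pad a b k l y) (pad a b k l d)"
    using step_pad[of p n1 m1 d k l] y(2) Suc.prems 1 assms(6,7) unfolding yp by simp
  moreover have "(step A ^^ i) (Conf q (two_block a b (n + k) (m + l))) (pad a b k l y)"
    using Suc.IH[OF y(1)] Suc.prems yp by simp
  ultimately show ?case by auto
qed

end

section \<open>Length bounds, two-block members of the language, and shortest runs\<close>

lemma exists_lengths_bound:
  assumes "rdfawtw A"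
  shows "\<exists>L>0. \<forall>q\<in>states A. \<forall>t\<in>transl A q. length t \<le> L \<and> length t dvd fact L"
proof -
  let ?T = "\<Union>q\<in>states A. transl A q"
  have fin: "finite ?T" using assms by (auto simp: rdfawtw_def rnfawtw_def)
  \<comment> \<open>The inserted 0 keeps \<open>Max\<close> defined without translucent words, and
    \<open>Suc\<close> makes the bound positive. Translucent words are non-empty, so each length
    divides the factorial.\<close>
  let ?L = "Suc (Max (insert 0 (length ` ?T)))"
  have "length t \<le> ?L \<and> length t dvd fact ?L" if "q \<in> states A" "t \<in> transl A q" for q t
  proof -
    have "length t \<le> Max (insert 0 (length ` ?T))"
      using fin that by (intro Max_ge) auto
    moreover have "length t > 0"
      using rdfawtw_prefix_code[OF assms that(1)] that(2) by (auto simp: prefix_code_def)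
    ultimately show ?thesis by (intro conjI dvd_fact) (auto simp: Suc_le_eq)
  qed
  then show ?thesis by blast
qed

lemma two_block_in_L_or:
  assumes "a \<noteq> b"
  shows "two_block a b n m \<in> L_or a b \<longleftrightarrow> m = n \<or> m = 2 * n"
proof -
  have "count_list (replicate i x) y = (if x = y then i else 0)" for i and x y :: 'a
    by (induction i) auto
  moreover have "two_block a b n m \<in> lists {a, b}" by (auto simp: two_block_def)
  ultimately show ?thesis using assms by (auto simp: L_or_def two_block_def)
qed

text \<open>In a run of least length no element repeats, since the loop between two occurrences
  could be cut out.\<close>

lemma shortest_run:
  assumes "R\<^sup>*\<^sup>* x y"
  obtains f T where "f 0 = x" "f T = y" "\<And>i. i < T \<Longrightarrow> R (f i) (f (Suc i))" "inj_on f {..T}"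
proof -
  define T where "T = (LEAST n. (R ^^ n) x y)"
  have "(R ^^ T) x y"
    unfolding T_def using assms by (metis LeastI rtranclp_imp_relpowp)
  then obtain f where f: "f 0 = x" "f T = y" "\<forall>i<T. R (f i) (f (Suc i))"
    by (auto simp: relpowp_fun_conv)
  have run: "(R ^^ (j - i)) (f i) (f j)" if "i \<le> j" "j \<le> T" for i j
    unfolding relpowp_fun_conv using f(3) that by (intro exI[of _ "\<lambda>k. f (i + k)"]) auto
  have "f i \<noteq> f j" if "i < j" "j \<le> T" for i j
  proof
    assume eq: "f i = f j"
    have "(R ^^ (i - 0)) (f 0) (f i)" "(R ^^ (T - j)) (f j) (f T)"
      by (rule run; use that in simp)+
    then have "(R ^^ (i + (T - j))) x y" using f eq by (auto simp: relpowp_add)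
    then have "T \<le> i + (T - j)" unfolding T_def by (rule Least_le)
    then show False using that by simp
  qed
  then have "inj_on f {..T}" by (intro linorder_inj_onI) auto
  then show ?thesis using that f by blast
qed

section \<open>The pigeonhole and pumping argument\<close>

context periodic_rdfawtw
begin

lemma lang_not_L_or:
  assumes ab: "a \<noteq> b" and P_pos: "0 < P"
  shows "lang A \<noteq> L_or a b"
proof
  assume lang: "lang A = L_or a b"
  obtain q0 where q0: "initial A = {q0}" "q0 \<in> states A"
    using det by (auto simp: rdfawtw_def rnfawtw_def card_1_singleton_iff)
  have acc: "(step A)\<^sup>*\<^sup>* (Conf q0 (two_block a b i j)) Accept \<longleftrightarrow> j = i \<or> j = 2 * i" for i j
  proof -
    have "two_block a b i j \<in> lists (alphabet A)"
      using letters by (auto simp: two_block_def)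
    then show ?thesis
      using two_block_in_L_or[OF ab, of i j] unfolding lang[symmetric] by (auto simp: lang_def q0)
  qed
  \<comment> \<open>\<open>K\<close> counts the triples of a state and two residues modulo
    \<open>P\<close>. The choice of \<open>n\<close> makes it a valid padding amount, leaves room
    for \<open>K\<close> steps in \<open>run_pad\<close>, and makes it larger than any loss within
    those steps.\<close>
  define K where "K = card (states A) * (P * P)"
  define n where "n = P * (2 * (L + K) + 1)"
  have n: "L + K \<le> n" "P dvd n" "0 < n" "2 * K < n"
  proof -
    have "1 * (2 * (L + K) + 1) \<le> n" unfolding n_def using P_pos by (intro mult_le_mono1) simp
    then show "L + K \<le> n" "0 < n" "2 * K < n" by auto
    show "P dvd n" by (simp add: n_def)
  qed
  obtain f T where f: "f 0 = Conf q0 (two_block a b n n)" "f T = Accept"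
      "\<And>i. i < T \<Longrightarrow> step A (f i) (f (Suc i))" "inj_on f {..T}"
    using shortest_run acc[of n n] by metis
  have run: "(step A ^^ (j - i)) (f i) (f j)" if "i \<le> j" "j \<le> T" for i j
    unfolding relpowp_fun_conv using f(3) that by (intro exI[of _ "\<lambda>k. f (i + k)"]) auto
  have run0: "(step A ^^ j) (Conf q0 (two_block a b n n)) (f j)" if "j \<le> T" for j
    using run[of 0 j] that f(1) by simp

  have late: "K < T"
  proof (rule ccontr)
    assume "\<not> K < T"
    \<comment> \<open>So short a run could be padded up to its end. The padding by \<open>n\<close>,
      a positive multiple of \<open>P\<close>, leads to acceptance of a word with fewer
      \<open>b\<close> than \<open>a\<close>.\<close>
    then have "(step A ^^ T) (Conf q0 (two_block a b (n + n) n)) (pad a b n 0 Accept)"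
      using run_pad[of T q0 n n Accept n 0] run0[of T] f(2) q0(2) n by simp
    then have "(step A)\<^sup>*\<^sup>* (Conf q0 (two_block a b (n + n) n)) Accept"
      by (simp add: relpowp_imp_rtranclp)
    then show False using acc n by simp
  qed

  have conf: "\<exists>q i' j'. f i = Conf q (two_block a b i' j') \<and> q \<in> states A" if "i \<le> K" for i
  proof -
    \<comment> \<open>A configuration with a successor is neither \<open>Accept\<close> nor
      \<open>Reject\<close>.\<close>
    have "step A (f i) (f (Suc i))" using f(3) that late by simp
    then obtain q w where w: "f i = Conf q w" by (cases "f i") auto
    then have "(step A ^^ i) (Conf q0 (two_block a b n n)) (Conf q w)"
      using run0[of i] that late by simp
    then show ?thesis using run_two_block q0(2) w by metis
  qed
  obtain qs ns ms where s: "\<And>i. i \<le> K \<Longrightarrow>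
      f i = Conf (qs i) (two_block a b (ns i) (ms i)) \<and> qs i \<in> states A"
    using conf by metis

  let ?g = "\<lambda>i. (qs i, ns i mod P, ms i mod P)"
  have fin: "finite (states A)" using det by (simp add: rdfawtw_def rnfawtw_def)
  have "?g ` {..K} \<subseteq> states A \<times> {..<P} \<times> {..<P}" using s P_pos by auto
  then have "card (?g ` {..K}) \<le> card (states A \<times> {..<P} \<times> {..<P})"
    using fin by (intro card_mono) auto
  then have "card (?g ` {..K}) < card {..K}" by (simp add: K_def card_cartesian_product)
  then have "\<not> inj_on ?g {..K}" by (rule pigeonhole)
  then obtain i j where ij: "i < j" "j \<le> K" "?g i = ?g j"
    unfolding inj_on_def by (metis atMost_iff linorder_neqE_nat)
  let ?c = "Conf (qs i) (two_block a b (ns i) (ms i))"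
  have fi: "f i = ?c" and fj: "f j = Conf (qs i) (two_block a b (ns j) (ms j))"
    using s[of i] s[of j] ij by auto

  obtain \<alpha> \<beta> where ab': "ns i = ns j + \<alpha>" "ms i = ms j + \<beta>" "\<alpha> \<le> K" "\<beta> \<le> K"
  proof -
    have "(step A ^^ (j - i)) ?c (f j)" "qs i \<in> states A"
      using run[of i j] ij late fi s[of i] by simp_all
    then obtain n' m' where nm: "two_block a b (ns j) (ms j) = two_block a b n' m'"
        "n' \<le> ns i" "ns i \<le> n' + (j - i)" "m' \<le> ms i" "ms i \<le> m' + (j - i)"
      unfolding fj by (rule run_two_block)
    have "n' = ns j" "m' = ms j"
    proof -
      \<comment> \<open>As \<open>a\<close> and \<open>b\<close> differ, the word determines its
        exponents: the first by filtering, the second by length.\<close>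
      have "filter (\<lambda>y. y = a) (two_block a b (ns j) (ms j)) = filter (\<lambda>y. y = a) (two_block a b n' m')"
        using nm(1) by simp
      then show "n' = ns j" using ab by (simp add: two_block_def filter_replicate)
      then show "m' = ms j" using arg_cong[OF nm(1), of length] by (simp add: two_block_def)
    qed
    then show ?thesis using that[of "ns i - ns j" "ms i - ms j"] nm ij by simp
  qed
  have dvd: "P dvd \<alpha>" "P dvd \<beta>"
    using ij(3) mod_eq_dvd_iff_nat[of "ns j" "ns i" P] mod_eq_dvd_iff_nat[of "ms j" "ms i" P] ab'
    by auto

  \<comment> \<open>The padding restores exactly the letters lost between \<open>i\<close> and
    \<open>j\<close>, so the padded run returns to the start of the segment. The \<open>l\<close>
    extra letters \<open>b\<close> serve both inputs: 0 for equal blocks, \<open>n\<close> for the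
    doubled block.\<close>
  have pad_fj: "pad a b \<alpha> (\<beta> + l) (f j) = pad a b 0 l (f i)" for l
    unfolding fj fi by (simp add: ab' ac_simps)
  have pump: "(step A)\<^sup>*\<^sup>* (Conf q0 (two_block a b (n + \<alpha>) (n + (\<beta> + l)))) Accept"
    if "P dvd l" "(step A)\<^sup>*\<^sup>* (pad a b 0 l (f i)) Accept" for l
  proof -
    have "(step A ^^ j) (Conf q0 (two_block a b (n + \<alpha>) (n + (\<beta> + l)))) (pad a b \<alpha> (\<beta> + l) (f j))"
      using run_pad[of j q0 n n "f j" \<alpha> "\<beta> + l"] run0[of j] ij late n q0(2) dvd that(1) fj by simp
    then show ?thesis
      using that(2) unfolding pad_fj by (meson relpowp_imp_rtranclp rtranclp_trans)
  qed

  have "(step A)\<^sup>*\<^sup>* (f i) Accept"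
    using run[of i T] ij late f(2) by (simp add: relpowp_imp_rtranclp)
  then have "(step A)\<^sup>*\<^sup>* (pad a b 0 0 (f i)) Accept" by (simp add: fi)
  then have "n + \<beta> = n + \<alpha> \<or> n + \<beta> = 2 * (n + \<alpha>)" using pump[of 0] acc by simp
  \<comment> \<open>The other alternative would make \<beta> at least \<open>n\<close>, which
    exceeds \<open>K\<close>.\<close>
  then have 1: "\<alpha> = \<beta>" using ab' n by auto

  \<comment> \<open>The input with the doubled block starts with the same \<open>i\<close> steps. By
    determinism its accepting run passes through this padded configuration, which therefore leads to
    acceptance.\<close>
  have "(step A ^^ i) (Conf q0 (two_block a b (n + 0) (n + n))) (pad a b 0 n (f i))"
    using run_pad[of i q0 n n "f i" 0 n] run0[of i] ij late n q0(2) fi by simp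
  then have "(step A)\<^sup>*\<^sup>* (Conf q0 (two_block a b n (n + n))) (pad a b 0 n (f i))"
    by (simp add: relpowp_imp_rtranclp)
  moreover have "(step A)\<^sup>*\<^sup>* (Conf q0 (two_block a b n (n + n))) Accept"
    using acc by simp
  ultimately have "(step A)\<^sup>*\<^sup>* (pad a b 0 n (f i)) Accept"
    using accepting_run_unique[OF det] by (simp add: fi)
  then have "n + (\<beta> + n) = n + \<alpha> \<or> n + (\<beta> + n) = 2 * (n + \<alpha>)" using pump[of n] acc n by blast
  \<comment> \<open>Here the other alternative would make \<alpha> at least
    \<open>n\<close>.\<close>
  then have "\<beta> = 2 * \<alpha>" using ab' n by auto
  with 1 have "\<alpha> = 0" "\<beta> = 0" by auto
  then have "f i = f j" using fi fj ab' by simp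
  then show False using f(4) ij late by (auto dest: inj_onD)
qed

end

theorem theorem18:
  fixes a b :: 'a
  assumes "a \<noteq> b"
  shows "\<not> (\<exists>A :: ('q, 'a) rfawtw. rdfawtw A \<and> lang A = L_or a b)"
proof
  assume "\<exists>A :: ('q, 'a) rfawtw. rdfawtw A \<and> lang A = L_or a b"
  then obtain A :: "('q, 'a) rfawtw" where A: "rdfawtw A" "lang A = L_or a b" by blast
  \<comment> \<open>The alphabet of \<open>A\<close> is not fixed in advance; an accepted word
    containing both letters shows that they belong to it.\<close>
  have "two_block a b 1 1 \<in> lang A"
    using two_block_in_L_or[OF assms, of 1 1] A(2) by simp
  then have letters: "a \<in> alphabet A" "b \<in> alphabet A" by (auto simp: lang_def two_block_def)
  obtain L where "0 < L"
      "\<forall>q\<in>states A. \<forall>t\<in>transl A q. length t \<le> L \<and> length t dvd fact L"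
    using exists_lengths_bound[OF A(1)] by blast
  then interpret periodic_rdfawtw A a b L "fact L"
    using A(1) letters by unfold_locales auto
  show False using lang_not_L_or[OF assms] A(2) by simp
qed

end
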